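(* Every generalized polynomial $f:\mathbb{R}\to\mathbb{R}$ is bilaterally $\mathbb{Q}$-continuous. More precisely, for every generalized polynomial $f:\mathbb{R}\to\mathbb{R}$ and every $y<z$ there exists an ordinary polynomial function $G_{y,z}:\mathbb{R}\to\mathbb{R}$ such that $G_{y,z}(t)=f(t)$ for every $t\in L(y,z)$.
   Context: For $h\neq0$ and $f:\mathbb{R}\to\mathbb{R}$, the forward difference is $\Delta_h^1f(x)=f(x+h)-f(x)$, and $\Delta_h^nf=\Delta_h^1(\Delta_h^{n-1}f)$ for $n\ge2$. A $0$-monomial is a constant function. For an integer $n\ge1$, an $n$-monomial is a function $f:\mathbb{R}\to\mathbb{R}$ satisfying Fréchet's equation $\frac{1}{n!}\Delta_h^nf(x)=f(h)$ for all $x,h\in\mathbb{R}$ with $h\neq 0$. A generalized polynomial (called simply "polynomial" in the paper) is a finite sum of monomials; no continuity is assumed. An ordinary polynomial is a polynomial function with real coefficients. For real $y\neq z$ put $L(y,z)=\{qy+(1-q)z:q\in\mathbb{Q}\}$ and $S(y,z)=\{qy+(1-q)z: q\in\mathbb{Q}\cap[0,1]\}$. A function $f:\mathbb{R}\to\mathbb{R}$ is bilaterally $\mathbb{Q}$-continuous if for every $x\in\mathbb{R}$ there is $\epsilon>0$ such that for all $y,z$ with $x-\epsilon\le y<z\le x+\epsilon$ there is a continuous function $f_{y,z}:[y,z]\to\mathbb{R}$ with $f_{y,z}(t)=f(t)$ for all $t\in S(y,z)$. *)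

theory Defs
  imports Complex_Main "HOL-Computational_Algebra.Polynomial"
begin

definition fwd_diff :: "real \<Rightarrow> (real \<Rightarrow> real) \<Rightarrow> real \<Rightarrow> real" where
  "fwd_diff h f = (\<lambda>x. f (x + h) - f x)"

text \<open>The \<open>n\<close>-th forward difference with step \<open>h\<close> is the iterate \<open>(fwd_diff h ^^ n) f\<close>.\<close>

definition n_monomial :: "nat \<Rightarrow> (real \<Rightarrow> real) \<Rightarrow> bool" where
  "n_monomial n f \<longleftrightarrow>
     (if n = 0 then \<exists>c. \<forall>x. f x = c
      else \<forall>x h. h \<noteq> 0 \<longrightarrow> 1 / fact n * (fwd_diff h ^^ n) f x = f h)"

definition generalized_polynomial :: "(real \<Rightarrow> real) \<Rightarrow> bool" where
  "generalized_polynomial f \<longleftrightarrow>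
     (\<exists>(N::nat) (g :: nat \<Rightarrow> real \<Rightarrow> real).
        (\<forall>i<N. \<exists>n. n_monomial n (g i)) \<and> (\<forall>x. f x = (\<Sum>i<N. g i x)))"

definition rat_line :: "real \<Rightarrow> real \<Rightarrow> real set" where
  "rat_line y z = {q * y + (1 - q) * z | q. q \<in> \<rat>}"

definition rat_segment :: "real \<Rightarrow> real \<Rightarrow> real set" where
  "rat_segment y z = {q * y + (1 - q) * z | q. q \<in> \<rat> \<inter> {0..1}}"

definition bilaterally_Q_continuous :: "(real \<Rightarrow> real) \<Rightarrow> bool" where
  "bilaterally_Q_continuous f \<longleftrightarrow>
     (\<forall>x. \<exists>\<epsilon>>0. \<forall>y z. x - \<epsilon> \<le> y \<and> y < z \<and> z \<le> x + \<epsilon> \<longrightarrow>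
        (\<exists>g :: real \<Rightarrow> real. continuous_on {y..z} g \<and> (\<forall>t\<in>rat_segment y z. g t = f t)))"

end

theory Submission
  imports Defs
begin

text \<open>
  A generalized polynomial is annihilated by some fixed power of every forward difference
  operator: an \<open>n\<close>-monomial has a constant \<open>n\<close>-th difference, so its next difference vanishes.
  This is the only property of monomials that matters.  If \<open>\<Delta>\<^sub>h\<^sup>m f = 0\<close>, the Gregory--Newton
  formula
  \<open>f (x + k h) = (\<Sum>j<m. (\<Delta>\<^sub>h\<^sup>j f) x * (k gchoose j))\<close> for integers \<open>k\<close>
  shows that \<open>f\<close> is an ordinary polynomial along the arithmetic progression \<open>x + \<int> h\<close>.

  The rational line \<open>x + \<rat> d\<close> is the union of the progressions \<open>x + \<int> (d / N)\<close> with \<open>N \<ge> 1\<close>.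
  Each of them contains the infinite progression \<open>x + \<int> d\<close>, and polynomials agreeing on an
  infinite set are equal.  Hence the polynomials belonging to the different \<open>N\<close> are one
  and the same polynomial, after rescaling the variable, and it represents \<open>f\<close> on the
  whole line.  As ordinary polynomials are continuous, bilateral \<open>\<rat>\<close>-continuity follows.
\<close>

section \<open>Vanishing differences of generalized polynomials\<close>

lemma fwd_diff_funpow_zero: "(fwd_diff h ^^ n) (\<lambda>x. 0) = (\<lambda>x. 0)"
  by (induction n) (simp_all add: fwd_diff_def)

lemma fwd_diff_funpow_add:
  "(fwd_diff h ^^ n) (\<lambda>x. f x + g x) = (\<lambda>x. (fwd_diff h ^^ n) f x + (fwd_diff h ^^ n) g x)"
  by (induction n) (simp_all add: fwd_diff_def algebra_simps)

lemma fwd_diff_funpow_eq_zero_mono: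
  assumes "(fwd_diff h ^^ m) f = (\<lambda>x. 0)" and "m \<le> n"
  shows "(fwd_diff h ^^ n) f = (\<lambda>x. 0)"
proof -
  have "(fwd_diff h ^^ n) f = (fwd_diff h ^^ (n - m)) ((fwd_diff h ^^ m) f)"
    using assms(2) by (metis comp_apply funpow_add le_add_diff_inverse2)
  then show ?thesis
    by (simp add: assms(1) fwd_diff_funpow_zero)
qed

text \<open>
  Frechet's equation says that the \<open>n\<close>-th difference with step \<open>h \<noteq> 0\<close> does not depend on the
  base point.  The step \<open>h = 0\<close>, about which the equation is silent, is harmless since \<open>fwd_diff 0\<close>
  is the zero operator.
\<close>

lemma n_monomial_fwd_diff_eq_zero:
  assumes "n_monomial n f"
  shows "(fwd_diff h ^^ Suc n) f = (\<lambda>x. 0)"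
proof (cases "h = 0")
  case True
  then show ?thesis by (simp add: fwd_diff_def)
next
  case False
  have "\<exists>c. (fwd_diff h ^^ n) f = (\<lambda>x. c)"
  proof (cases "n = 0")
    case True
    then show ?thesis using assms by (auto simp: n_monomial_def)
  next
    case n: False
    have "(fwd_diff h ^^ n) f x = fact n * f h" for x
      using assms n False by (simp add: n_monomial_def field_simps)
    then show ?thesis by blast
  qed
  then show ?thesis by (auto simp: fwd_diff_def)
qed

lemma generalized_polynomial_fwd_diff_eq_zero:
  assumes "generalized_polynomial f"
  obtains m where "\<And>h. (fwd_diff h ^^ m) f = (\<lambda>x. 0)"
proof -
  obtain N g where g: "\<And>i. i < (N::nat) \<Longrightarrow> \<exists>n. n_monomial n (g i)"
    and f: "f = (\<lambda>x. \<Sum>i<N. g i x)"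
    using assms unfolding generalized_polynomial_def by (auto simp: fun_eq_iff)
  have "\<exists>m. \<forall>h. (fwd_diff h ^^ m) (\<lambda>x. \<Sum>i<N. g i x) = (\<lambda>x. 0)"
    using g
  proof (induction N)
    case 0
    show ?case by (simp add: fwd_diff_funpow_zero)
  next
    case (Suc N)
    obtain m where m: "\<And>h. (fwd_diff h ^^ m) (\<lambda>x. \<Sum>i<N. g i x) = (\<lambda>x. 0)"
      using Suc.IH Suc.prems less_SucI by blast
    obtain n where n: "\<And>h. (fwd_diff h ^^ Suc n) (g N) = (\<lambda>x. 0)"
      using Suc.prems[of N] n_monomial_fwd_diff_eq_zero by blast
    have "(fwd_diff h ^^ max m (Suc n)) (\<lambda>x. \<Sum>i<Suc N. g i x) = (\<lambda>x. 0)" for h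
      using fwd_diff_funpow_eq_zero_mono[OF m[of h], of "max m (Suc n)"]
        fwd_diff_funpow_eq_zero_mono[OF n[of h], of "max m (Suc n)"]
      by (simp add: fwd_diff_funpow_add)
    then show ?case by blast
  qed
  then show thesis using that f by blast
qed

section \<open>Arithmetic progressions\<close>

text \<open>
  Both sides of the Gregory--Newton formula agree at \<open>k = 0\<close>, and by induction on the
  order \<open>m\<close> and Pascal's rule they have the same first difference in \<open>k\<close>; a difference equation of
  first order determines the values at negative \<open>k\<close> as well.
\<close>

lemma gregory_newton:
  assumes "(fwd_diff h ^^ m) f = (\<lambda>x. 0)"
  shows "f (x + of_int k * h) = (\<Sum>j<m. (fwd_diff h ^^ j) f x * (of_int k gchoose j))"
  using assms
proof (induction m arbitrary: f k)
  case 0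
  then show ?case by (simp add: fun_eq_iff)
next
  case (Suc m)
  define S where
    "S k = (\<Sum>j<Suc m. (fwd_diff h ^^ j) f x * (real_of_int k gchoose j))" for k
  have S_step: "S (k + 1) - S k = f (x + of_int (k + 1) * h) - f (x + of_int k * h)" for k
  proof -
    have "S (k + 1) - S k =
        (\<Sum>j<m. (fwd_diff h ^^ Suc j) f x *
          ((real_of_int k + 1 gchoose Suc j) - (real_of_int k gchoose Suc j)))"
      unfolding S_def
      by (simp add: sum.lessThan_Suc_shift sum_subtractf right_diff_distrib del: sum.lessThan_Suc)
    also have "\<dots> = (\<Sum>j<m. (fwd_diff h ^^ j) (fwd_diff h f) x * (real_of_int k gchoose j))"
      by (simp add: gbinomial_Suc_Suc funpow_swap1)
    also have "\<dots> = fwd_diff h f (x + of_int k * h)"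
      using Suc.IH[of "fwd_diff h f" k] Suc.prems by (simp add: funpow_swap1)
    finally show ?thesis
      by (simp add: fwd_diff_def algebra_simps)
  qed
  have "f (x + of_int k * h) = S k"
  proof (induction k rule: int_induct[where k = 0])
    case base
    show ?case
      by (simp add: S_def sum.lessThan_Suc_shift del: sum.lessThan_Suc)
  next
    case (step1 k)
    then show ?case using S_step[of k] by simp
  next
    case (step2 k)
    then show ?case using S_step[of "k - 1"] by simp
  qed
  then show ?case by (simp add: S_def)
qed

lemma gbinomial_eq_poly:
  fixes t :: "'a :: field_char_0"
  shows "t gchoose j = poly (smult (1 / fact j) (\<Prod>i<j. [:- of_nat i, 1:])) t"
  by (simp add: gbinomial_prod_rev poly_prod lessThan_atLeast0)

lemma poly_on_arithmetic_progression:
  assumes "(fwd_diff h ^^ m) f = (\<lambda>x. 0)"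
  obtains p :: "real poly" where "\<And>k. f (x + of_int k * h) = poly p (of_int k)"
proof
  show "f (x + of_int k * h) = poly (\<Sum>j<m. smult ((fwd_diff h ^^ j) f x)
      (smult (1 / fact j) (\<Prod>i<j. [:- of_nat i, 1:]))) (of_int k)" for k
    by (simp only: gregory_newton[OF assms] gbinomial_eq_poly poly_sum poly_smult)
qed

section \<open>Rational lines\<close>

lemma poly_eqI_on_Ints:
  fixes p q :: "'a :: {idom, ring_char_0} poly"
  assumes "\<And>k::int. poly p (of_int k) = poly q (of_int k)"
  shows "p = q"
proof (rule ccontr)
  assume "p \<noteq> q"
  then have "finite {t. poly (p - q) t = 0}"
    by (intro poly_roots_finite) simp
  moreover have "range of_int \<subseteq> {t. poly (p - q) t = 0}"
    using assms by auto
  ultimately have "finite (range (of_int :: int \<Rightarrow> 'a))"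
    by (rule rev_finite_subset)
  then show False
    using finite_imageD[of "of_int :: int \<Rightarrow> 'a" UNIV] by (auto simp: inj_on_def)
qed

text \<open>
  The progression with step \<open>d / N\<close> contains the infinite progression \<open>x + \<int> d\<close>, so its
  polynomial, rescaled by \<open>N\<close>, coincides with the one for the step \<open>d\<close>.
\<close>

lemma poly_on_rational_line:
  assumes "\<And>h. (fwd_diff h ^^ m) f = (\<lambda>x. 0)"
  obtains p :: "real poly" where "\<And>q. q \<in> \<rat> \<Longrightarrow> f (x + q * d) = poly p q"
proof -
  obtain p :: "real poly" where p: "\<And>k. f (x + of_int k * d) = poly p (of_int k)"
    using poly_on_arithmetic_progression[OF assms] by metis
  have "f (x + q * d) = poly p q" if "q \<in> \<rat>" for q
  proof -
    obtain k N where N: "N > 0" and q: "q = of_int k / of_int N"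
      using \<open>q \<in> \<rat>\<close> by (elim Rats_cases') auto
    obtain r :: "real poly"
      where r: "\<And>j. f (x + of_int j * (d / of_int N)) = poly r (of_int j)"
      using poly_on_arithmetic_progression[OF assms] by metis
    have "pcompose r [:0, of_int N:] = p"
    proof (rule poly_eqI_on_Ints)
      fix j :: int
      have "x + of_int (N * j) * (d / of_int N) = x + of_int j * d"
        using N by simp
      then show "poly (pcompose r [:0, of_int N:]) (of_int j) = poly p (of_int j)"
        using r[of "N * j"] p[of j] by (simp add: poly_pcompose mult.commute)
    qed
    then have "poly p q = poly r (of_int k)"
      using N q by (auto simp: poly_pcompose)
    then show ?thesis
      using r[of k] q by simp
  qed
  then show thesis using that by blast
qed

lemma poly_on_rat_line:
  assumes "generalized_polynomial f" and "y \<noteq> z"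
  obtains G :: "real poly" where "\<And>t. t \<in> rat_line y z \<Longrightarrow> poly G t = f t"
proof -
  obtain m where m: "\<And>h. (fwd_diff h ^^ m) f = (\<lambda>x. 0)"
    using generalized_polynomial_fwd_diff_eq_zero[OF assms(1)] by blast
  obtain p :: "real poly" where p: "\<And>q. q \<in> \<rat> \<Longrightarrow> f (z + q * (y - z)) = poly p q"
    using poly_on_rational_line[OF m] by metis
  (* The inner linear polynomial sends q y + (1 - q) z back to its coordinate q. *)
  define G where "G = pcompose p [:- z / (y - z), 1 / (y - z):]"
  have "poly G t = f t" if "t \<in> rat_line y z" for t
  proof -
    obtain q where q: "q \<in> \<rat>" and t: "t = z + q * (y - z)"
      using \<open>t \<in> rat_line y z\<close> unfolding rat_line_def by (auto simp: algebra_simps)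
    have "- z / (y - z) + t * (1 / (y - z)) = q"
      using assms(2) by (simp add: t add_divide_distrib)
    then show ?thesis
      using p[OF q] by (simp add: G_def t poly_pcompose)
  qed
  then show thesis using that by blast
qed

theorem theorem10p2:
  fixes f :: "real \<Rightarrow> real"
  assumes "generalized_polynomial f"
  shows "bilaterally_Q_continuous f \<and>
    (\<forall>y z. y < z \<longrightarrow> (\<exists>G :: real poly. \<forall>t\<in>rat_line y z. poly G t = f t))"
proof
  show line: "\<forall>y z. y < z \<longrightarrow> (\<exists>G :: real poly. \<forall>t\<in>rat_line y z. poly G t = f t)"
    using poly_on_rat_line[OF assms] by (metis less_irrefl)
  have segment: "rat_segment y z \<subseteq> rat_line y z" for y z
    unfolding rat_segment_def rat_line_def by auto
  have "\<exists>g. continuous_on {y..z} g \<and> (\<forall>t\<in>rat_segment y z. g t = f t)" if "y < z" for y z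
  proof -
    obtain G :: "real poly" where "\<forall>t\<in>rat_line y z. poly G t = f t"
      using line \<open>y < z\<close> by blast
    then have "continuous_on {y..z} (poly G)" "\<forall>t\<in>rat_segment y z. poly G t = f t"
      using segment by (auto intro!: continuous_intros)
    then show ?thesis by blast
  qed
  (* The extension exists on every interval, so any radius will do. *)
  then show "bilaterally_Q_continuous f"
    unfolding bilaterally_Q_continuous_def by (intro allI exI[of _ 1]) auto
qed

end
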